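(* Let $S$ be a numerical semigroup. The set of maximal elements of the void poset $(M(S),\preccurlyeq)$ is $PF(S)\setminus\{F(S)\}$.
   Context: A numerical semigroup $S$ is a subset of $\mathbb{N}_0=\{0,1,2,\dots\}$ containing $0$, closed under addition, with finite complement; elements of $\mathbb{N}_0\setminus S$ are its gaps, and its Frobenius number $F(S)$ is the largest gap (defined when $S\ne\mathbb{N}_0$, so here $S\neq\mathbb{N}_0$). The pseudo-Frobenius numbers of $S$ are $PF(S)=\{P\in \mathbb{N}_0\setminus S \mid P+s\in S \text{ for all } s\in S\setminus\{0\}\}$. The void of $S$ is the set $M(S)$ of gaps $a$ of $S$ such that $F(S)-a$ is also a gap of $S$, partially ordered by $x\preccurlyeq y$ iff $y-x\in S$; this is the void poset. *)

theory Defs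
  imports Main
begin

definition numerical_semigroup :: "nat set \<Rightarrow> bool" where
  "numerical_semigroup S \<longleftrightarrow>
     0 \<in> S \<and> (\<forall>x\<in>S. \<forall>y\<in>S. x + y \<in> S) \<and> finite (- S)"

definition gaps :: "nat set \<Rightarrow> nat set" where
  "gaps S = - S"

(* Only meaningful when S is a numerical semigroup different from UNIV,
   so that the set of gaps is finite and nonempty. *)
definition Frobenius :: "nat set \<Rightarrow> nat" where
  "Frobenius S = Max (gaps S)"

definition pseudo_Frobenius :: "nat set \<Rightarrow> nat set" where
  "pseudo_Frobenius S = {P \<in> gaps S. \<forall>s \<in> S - {0}. P + s \<in> S}"

(* The natural-number subtraction does not truncate for S as above:
   every gap a satisfies a \<le> Frobenius S. *)
definition void :: "nat set \<Rightarrow> nat set" where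
  "void S = {a \<in> gaps S. Frobenius S - a \<in> gaps S}"

(* y - x \<in> S is meant in the integers, hence the guard x \<le> y. *)
definition void_order :: "nat set \<Rightarrow> nat rel" where
  "void_order S = {(x, y) \<in> void S \<times> void S. x \<le> y \<and> y - x \<in> S}"

definition maximal_elements :: "'a set \<Rightarrow> 'a rel \<Rightarrow> 'a set" where
  "maximal_elements A r = {m \<in> A. \<forall>a \<in> A. (m, a) \<in> r \<longrightarrow> a = m}"

lemma partial_order_on_void_order:
  assumes "numerical_semigroup S"
  shows "partial_order_on (void S) (void_order S)"
proof -
  have "z - x \<in> S" if "x \<le> y" "y \<le> z" "y - x \<in> S" "z - y \<in> S" for x y z
  proof -
    have "(z - y) + (y - x) \<in> S"
      using assms that unfolding numerical_semigroup_def by blast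
    then show ?thesis using that by simp
  qed
  then have "trans (void_order S)"
    unfolding void_order_def trans_def by (auto intro: order_trans)
  moreover have "refl_on (void S) (void_order S)" "antisym (void_order S)"
    "void_order S \<subseteq> void S \<times> void S"
    using assms
    by (auto simp: numerical_semigroup_def void_order_def refl_on_def antisym_def)
  ultimately show ?thesis
    by (simp add: partial_order_on_def preorder_on_def)
qed

end

theory Submission
  imports Defs
begin

text \<open>Write F for \<open>Frobenius S\<close>. The void is closed under going up inside the
  gaps: if m is in the void, s is in S and m + s is a gap, then F - (m + s) is a gap too, since
  adding s to it gives the gap F - m. So a maximal m has no gap of the form m + s with s nonzero in
  S, which is the pseudo-Frobenius condition. Conversely, if P is pseudo-Frobenius and P \<noteq> F,
  then F - P cannot lie in S, as P + (F - P) = F is a gap; hence P is in the void, and nothing lies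
  strictly above it because every such P + s is in S.\<close>

lemma Frobenius_not_mem:
  assumes "numerical_semigroup S" and "S \<noteq> UNIV"
  shows "Frobenius S \<notin> S"
proof -
  have "finite (gaps S)" "gaps S \<noteq> {}"
    using assms by (auto simp: numerical_semigroup_def gaps_def)
  then have "Frobenius S \<in> gaps S"
    unfolding Frobenius_def by (rule Max_in)
  then show ?thesis by (simp add: gaps_def)
qed

lemma le_Frobenius:
  assumes "numerical_semigroup S" and "a \<notin> S"
  shows "a \<le> Frobenius S"
  using assms by (simp add: numerical_semigroup_def gaps_def Frobenius_def)

theorem proposition2p2:
  fixes S :: "nat set"
  assumes "numerical_semigroup S" and "S \<noteq> UNIV"
  shows "maximal_elements (void S) (void_order S) = pseudo_Frobenius S - {Frobenius S}"
proof -
  let ?F = "Frobenius S"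
  have zero: "0 \<in> S" and add: "\<And>x y. x \<in> S \<Longrightarrow> y \<in> S \<Longrightarrow> x + y \<in> S"
    using assms(1) by (auto simp: numerical_semigroup_def)
  have mem_void: "a \<in> void S \<longleftrightarrow> a \<notin> S \<and> ?F - a \<notin> S" for a
    by (simp add: void_def gaps_def)
  show ?thesis
  proof (intro set_eqI iffI)
    fix m assume "m \<in> maximal_elements (void S) (void_order S)"
    then have m: "m \<in> void S" and max: "\<And>a. (m, a) \<in> void_order S \<Longrightarrow> a = m"
      by (auto simp: maximal_elements_def void_order_def)
    have "m + s \<in> S" if s: "s \<in> S" "s \<noteq> 0" for s
    proof (rule ccontr)
      assume gap: "m + s \<notin> S"
      \<comment> \<open>The subtraction does not truncate: the gap m + s is at most F.\<close>
      then have "?F - m = (?F - (m + s)) + s"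
        using le_Frobenius[OF assms(1) gap] by simp
      then have "?F - (m + s) \<notin> S"
        using m s(1) add[of "?F - (m + s)" s] by (auto simp: mem_void)
      then have "(m, m + s) \<in> void_order S"
        using m gap s by (simp add: void_order_def mem_void)
      then show False using max[of "m + s"] s(2) by simp
    qed
    \<comment> \<open>F is outside the void because F - F = 0 lies in S.\<close>
    moreover have "m \<noteq> ?F" using m zero by (auto simp: mem_void)
    ultimately show "m \<in> pseudo_Frobenius S - {?F}"
      using m by (simp add: pseudo_Frobenius_def gaps_def mem_void)
  next
    fix P assume "P \<in> pseudo_Frobenius S - {?F}"
    then have gap: "P \<notin> S" and pf: "\<And>s. s \<in> S \<Longrightarrow> s \<noteq> 0 \<Longrightarrow> P + s \<in> S" and "P \<noteq> ?F"
      by (auto simp: pseudo_Frobenius_def gaps_def)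
    \<comment> \<open>Strictness makes F - P nonzero, so that \<open>pf\<close> applies to
      it.\<close>
    have "P < ?F"
      using le_Frobenius[OF assms(1) gap] \<open>P \<noteq> ?F\<close> by simp
    then have "?F - P \<notin> S"
      using pf[of "?F - P"] Frobenius_not_mem[OF assms] by auto
    with gap have "P \<in> void S" by (simp add: mem_void)
    moreover have "a = P" if "(P, a) \<in> void_order S" for a
    proof (rule ccontr)
      assume "a \<noteq> P"
      \<comment> \<open>The guard P \<le> a in the order makes this sum equal to a, which would then
        be both in S and a gap.\<close>
      then have "P + (a - P) \<in> S"
        using that by (intro pf) (auto simp: void_order_def)
      then show False using that by (simp add: void_order_def mem_void)
    qed
    ultimately show "P \<in> maximal_elements (void S) (void_order S)"
      by (simp add: maximal_elements_def)
  qed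
qed

end
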